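(* Let $G_1$ and $G_2$ be two graphs, and let $\Gamma'_1,\ldots,\Gamma'_{t+t'-q}$ be the subgraphs of $G_1+G_2$ defined in the context. Then $$D'(G_1+G_2)\leq\max\{D'(\Gamma'_1),\ldots,D'(\Gamma'_{t+t'-q})\}.$$
   Context: All graphs are finite and simple. The join $G=G_1+G_2$ of $G_1=(V_1,E_1)$, $G_2=(V_2,E_2)$ (disjoint) has vertex set $V_1\cup V_2$ and edge set $E_1\cup E_2\cup\{uv:u\in V_1,v\in V_2\}$. The distinguishing index $D'(X)$ is the least $d$ such that $X$ has an edge colouring with $d$ colours preserved by no non-identity automorphism. $G[X]$ is an induced subgraph; $\overline{N_G(v)}=V(G)\setminus N_G(v)$ where $N_G(v)$ is the neighbourhood of $v$. Partition of $V_1$: choose $v_1\in V_1$, set $A:=\overline{N_G(v_1)}$; while some vertex $v$ of $G$ satisfies $\overline{N_G(v)}\cap A\neq\emptyset$ and $\overline{N_G(v)}\not\subseteq A$, replace $A$ by $A\cup\overline{N_G(v)}$; the final set is $A_1$. Choose a vertex of $V_1$ outside $A_1$ and repeat to get $A_2$, etc., giving $V_1=A_1\cup\cdots\cup A_k$; the same procedure gives $V_2=B_1\cup\cdots\cup B_{k'}$. Partition $\{G[A_1],\ldots,G[A_k]\}$ into isomorphism classes $\mathcal{A}_1,\ldots,\mathcal{A}_t$ and $\{G[B_1],\ldots,G[B_{k'}]\}$ into isomorphism classes $\mathcal{B}_1,\ldots,\mathcal{B}_{t'}$. Let $q$ be the number of classes $\mathcal{A}_i$ whose members are isomorphic to the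 members of some $\mathcal{B}_j$, indexed so that for $1\leq i\leq q$ members of $\mathcal{A}_i$ are isomorphic to members of $\mathcal{B}_i$ and no other such isomorphisms occur. Set $\Gamma_i=\mathcal{A}_i\cup\mathcal{B}_i$ for $1\leq i\leq q$, $\Gamma_{q+i}=\mathcal{A}_{q+i}$ for $1\leq i\leq t-q$, and $\Gamma_{t+i}=\mathcal{B}_{q+i}$ for $1\leq i\leq t'-q$. Let $V(\Gamma_i)$ be the union of the vertex sets of the graphs in $\Gamma_i$, and let $\Gamma'_i=G[V(\Gamma_i)]$ (the graphs in $\Gamma_i$ together with all edges of $G$ having both ends in $V(\Gamma_i)$). *)

theory Defs
  imports "HOL-Library.Extended_Nat"
begin

section \<open>Finite simple graphs\<close>

record 'a graph =
  verts :: "'a set"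
  edges :: "'a set set"

definition simple_graph :: "'a graph \<Rightarrow> bool" where
  "simple_graph G \<longleftrightarrow> finite (verts G) \<and> (\<forall>e\<in>edges G. e \<subseteq> verts G \<and> card e = 2)"

definition join :: "'a graph \<Rightarrow> 'a graph \<Rightarrow> 'a graph" where
  "join G1 G2 = \<lparr>verts = verts G1 \<union> verts G2,
     edges = edges G1 \<union> edges G2 \<union> {{u, v} | u v. u \<in> verts G1 \<and> v \<in> verts G2}\<rparr>"

definition induced :: "'a graph \<Rightarrow> 'a set \<Rightarrow> 'a graph" where
  "induced G X = \<lparr>verts = X, edges = {e \<in> edges G. e \<subseteq> X}\<rparr>"

definition isomorphism :: "'a graph \<Rightarrow> 'b graph \<Rightarrow> ('a \<Rightarrow> 'b) \<Rightarrow> bool" where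
  "isomorphism X Y f \<longleftrightarrow> bij_betw f (verts X) (verts Y) \<and>
     (\<forall>u\<in>verts X. \<forall>v\<in>verts X. {u, v} \<in> edges X \<longleftrightarrow> {f u, f v} \<in> edges Y)"

definition isomorphic :: "'a graph \<Rightarrow> 'b graph \<Rightarrow> bool" where
  "isomorphic X Y \<longleftrightarrow> (\<exists>f. isomorphism X Y f)"

section \<open>Distinguishing index\<close>

definition distinguishing :: "'a graph \<Rightarrow> ('a set \<Rightarrow> nat) \<Rightarrow> bool" where
  "distinguishing X c \<longleftrightarrow>
     (\<forall>f. isomorphism X X f \<and> (\<forall>e\<in>edges X. c (f ` e) = c e) \<longrightarrow> (\<forall>v\<in>verts X. f v = v))"

text \<open>
  Some graphs have no distinguishing edge colouring at all (for instance \<open>K\<^sub>2\<close>, or two isolated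
  vertices); the infimum of the empty set gives them the value \<open>\<infinity>\<close>.
  A maximum of finitely many indices can be written as \<open>SUP\<close>: in \<^typ>\<open>enat\<close> this is \<open>Max\<close> on nonempty
  finite sets and \<open>0\<close> on the empty set.
\<close>

definition distinguishing_index :: "'a graph \<Rightarrow> enat" where
  "distinguishing_index X =
     Inf {enat d | d. \<exists>c. c ` edges X \<subseteq> {..<d} \<and> distinguishing X c}"

section \<open>The partition procedure\<close>

definition nbhd :: "'a graph \<Rightarrow> 'a \<Rightarrow> 'a set" where
  "nbhd G v = {u. {v, u} \<in> edges G}"

definition non_nbhd :: "'a graph \<Rightarrow> 'a \<Rightarrow> 'a set" where
  "non_nbhd G v = verts G - nbhd G v"

inductive absorb :: "'a graph \<Rightarrow> 'a set \<Rightarrow> 'a set \<Rightarrow> bool" for G where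
  "v \<in> verts G \<Longrightarrow> non_nbhd G v \<inter> A \<noteq> {} \<Longrightarrow> \<not> non_nbhd G v \<subseteq> A \<Longrightarrow>
     absorb G A (A \<union> non_nbhd G v)"

definition block_from :: "'a graph \<Rightarrow> 'a \<Rightarrow> 'a set \<Rightarrow> bool" where
  "block_from G v A \<longleftrightarrow> (absorb G)\<^sup>*\<^sup>* (non_nbhd G v) A \<and> (\<nexists>A'. absorb G A A')"

text \<open>
  The procedure involves arbitrary choices, so it is a relation: \<open>block_run G V As\<close> says that
  \<open>As\<close> is a list of blocks that can be produced, in this order, with starting vertices from \<open>V\<close>;
  \<open>block_partition G V As\<close> says that the run has exhausted \<open>V\<close>.
\<close>

inductive block_run :: "'a graph \<Rightarrow> 'a set \<Rightarrow> 'a set list \<Rightarrow> bool" for G V where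
  "block_run G V []"
| "block_run G V As \<Longrightarrow> v \<in> V - \<Union>(set As) \<Longrightarrow> block_from G v A \<Longrightarrow> block_run G V (As @ [A])"

definition block_partition :: "'a graph \<Rightarrow> 'a set \<Rightarrow> 'a set list \<Rightarrow> bool" where
  "block_partition G V As \<longleftrightarrow> block_run G V As \<and> V \<subseteq> \<Union>(set As)"

lemma absorb_terminates:
  assumes "finite (verts G)" and "A \<subseteq> verts G"
  shows "\<exists>A'. (absorb G)\<^sup>*\<^sup>* A A' \<and> (\<nexists>A''. absorb G A' A'')"
  using assms(2)
proof (induction "card (verts G - A)" arbitrary: A rule: less_induct)
  case less
  show ?case
  proof (cases "\<exists>B. absorb G A B")
    case True
    then obtain B where B: "absorb G A B" by blast
    then have sub: "A \<subset> B" "B \<subseteq> verts G"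
      using less.prems by (auto simp: absorb.simps non_nbhd_def)
    then have "verts G - B \<subset> verts G - A" by blast
    then have "card (verts G - B) < card (verts G - A)"
      using assms(1) by (simp add: psubset_card_mono)
    from less.hyps[OF this sub(2)] B show ?thesis
      by (meson converse_rtranclp_into_rtranclp)
  qed blast
qed

lemma block_partition_exists:
  assumes G: "simple_graph G" and V: "V \<subseteq> verts G"
  shows "\<exists>As. block_partition G V As"
proof -
  have fin: "finite (verts G)" using G by (simp add: simple_graph_def)
  have mem: "v \<in> A" if "v \<in> V" "block_from G v A" for v A
  proof -
    have "v \<notin> nbhd G v" using G by (auto simp: nbhd_def simple_graph_def)
    then have "v \<in> non_nbhd G v" using that V by (auto simp: non_nbhd_def)
    moreover have "X \<subseteq> Y" if "(absorb G)\<^sup>*\<^sup>* X Y" for X Y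
      using that by induction (auto simp: absorb.simps)
    ultimately show ?thesis using that by (auto simp: block_from_def)
  qed
  have "\<exists>Bs. block_partition G V Bs" if "block_run G V As" for As
    using that
  proof (induction "card (V - \<Union>(set As))" arbitrary: As rule: less_induct)
    case less
    show ?case
    proof (cases "V \<subseteq> \<Union>(set As)")
      case False
      then obtain v where v: "v \<in> V - \<Union>(set As)" by blast
      have "non_nbhd G v \<subseteq> verts G" by (auto simp: non_nbhd_def)
      from absorb_terminates[OF fin this] obtain A where A: "block_from G v A"
        by (auto simp: block_from_def)
      have "V - \<Union>(set (As @ [A])) \<subset> V - \<Union>(set As)" using mem[OF _ A] v by auto
      then have "card (V - \<Union>(set (As @ [A]))) < card (V - \<Union>(set As))"
        using fin V by (meson finite_Diff finite_subset psubset_card_mono)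
      from less.hyps[OF this] show ?thesis
        using block_run.intros(2)[OF less.prems v A] by blast
    qed (use less.prems in \<open>auto simp: block_partition_def\<close>)
  qed
  then show ?thesis using block_run.intros(1) by blast
qed

section \<open>Isomorphism classes of blocks and the families of blocks\<close>

definition iso_classes :: "'a graph set \<Rightarrow> 'a graph set set" where
  "iso_classes S = S // {(X, Y). X \<in> S \<and> Y \<in> S \<and> isomorphic X Y}"

definition matched :: "'a graph set \<Rightarrow> 'a graph set \<Rightarrow> bool" where
  "matched \<A> \<B> \<longleftrightarrow> (\<forall>X\<in>\<A>. \<forall>Y\<in>\<B>. isomorphic X Y)"

text \<open>
  The families \<open>\<Gamma>\<^sub>i\<close>, without their numbering: matched pairs of classes are merged, all other
  classes are kept as they are.
\<close>

definition merged_classes :: "'a graph set set \<Rightarrow> 'a graph set set \<Rightarrow> 'a graph set set" where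
  "merged_classes \<AA> \<BB> =
     {\<A> \<union> \<B> | \<A> \<B>. \<A> \<in> \<AA> \<and> \<B> \<in> \<BB> \<and> matched \<A> \<B>} \<union>
     {\<A> \<in> \<AA>. \<forall>\<B>\<in>\<BB>. \<not> matched \<A> \<B>} \<union>
     {\<B> \<in> \<BB>. \<forall>\<A>\<in>\<AA>. \<not> matched \<A> \<B>}"

definition families :: "'a graph \<Rightarrow> 'a set list \<Rightarrow> 'a set list \<Rightarrow> 'a graph set set" where
  "families G As Bs =
     merged_classes (iso_classes (induced G ` set As)) (iso_classes (induced G ` set Bs))"

text \<open>The set of the subgraphs \<open>\<Gamma>'\<^sub>i\<close>: all edges of \<open>G\<close> between the blocks of a family are included.\<close>

definition family_graphs :: "'a graph \<Rightarrow> 'a set list \<Rightarrow> 'a set list \<Rightarrow> 'a graph set" where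
  "family_graphs G As Bs = (\<lambda>\<Gamma>. induced G (\<Union>X\<in>\<Gamma>. verts X)) ` families G As Bs"

end

theory Submission
  imports Defs
begin

text \<open>
  The blocks are the connected components of the complement of \<open>G = G\<^sub>1 + G\<^sub>2\<close>, and the families
  are the isomorphism classes of the graphs induced on them. An automorphism of \<open>G\<close> permutes the
  components of the complement and respects their isomorphism types, so it restricts to an
  automorphism of every \<open>\<Gamma>'\<^sub>i\<close>. Hence distinguishing colourings of the \<open>\<Gamma>'\<^sub>i\<close>, extended by one of
  their colours to the edges between different \<open>\<Gamma>'\<^sub>i\<close>, form a distinguishing colouring of \<open>G\<close>.
  A colour is missing only if all \<open>\<Gamma>'\<^sub>i\<close> are edgeless and rigid, that is, single vertices; these
  are isomorphic, so then there is only one family and there are no edges between families.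
\<close>

section \<open>Isomorphisms and isomorphism classes\<close>

lemma isomorphism_inv_into:
  assumes "isomorphism X Y f"
  shows "isomorphism Y X (inv_into (verts X) f)"
proof -
  let ?g = "inv_into (verts X) f"
  have bij: "bij_betw f (verts X) (verts Y)"
    using assms by (simp add: isomorphism_def)
  have "bij_betw ?g (verts Y) (verts X)"
    using bij by (rule bij_betw_inv_into)
  moreover have "{u, v} \<in> edges Y \<longleftrightarrow> {?g u, ?g v} \<in> edges X"
    if "u \<in> verts Y" "v \<in> verts Y" for u v
  proof -
    have "?g u \<in> verts X" "?g v \<in> verts X" "f (?g u) = u" "f (?g v) = v"
      using bij that by (auto simp: bij_betw_def inv_into_into f_inv_into_f)
    then show ?thesis using assms by (metis isomorphism_def)
  qed
  ultimately show ?thesis by (simp add: isomorphism_def)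
qed

lemma isomorphic_refl: "isomorphic X X"
  unfolding isomorphic_def isomorphism_def by (rule exI[of _ id]) auto

lemma isomorphic_sym: "isomorphic X Y \<Longrightarrow> isomorphic Y X"
  unfolding isomorphic_def using isomorphism_inv_into by blast

lemma isomorphic_trans:
  assumes "isomorphic X Y" and "isomorphic Y Z"
  shows "isomorphic X Z"
proof -
  obtain f g where f: "isomorphism X Y f" and g: "isomorphism Y Z g"
    using assms by (auto simp: isomorphic_def)
  have "f u \<in> verts Y" if "u \<in> verts X" for u
    using f that by (auto simp: isomorphism_def bij_betw_def)
  then have "isomorphism X Z (g \<circ> f)"
    using f g by (auto simp: isomorphism_def intro: bij_betw_trans)
  then show ?thesis by (auto simp: isomorphic_def)
qed

text \<open>\<open>X\<close> may lie outside \<open>S\<close>, so one representative can be compared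
  with both sides of the join; the class is then possibly empty.\<close>

definition iso_class :: "'a graph set \<Rightarrow> 'a graph \<Rightarrow> 'a graph set" where
  "iso_class S X = {Y \<in> S. isomorphic X Y}"

lemma iso_classes_eq: "iso_classes S = iso_class S ` S"
  unfolding iso_classes_def quotient_def iso_class_def by (auto simp: Image_def)

lemma iso_class_cong: "isomorphic X Y \<Longrightarrow> iso_class S X = iso_class S Y"
  unfolding iso_class_def using isomorphic_sym isomorphic_trans by blast

lemma iso_class_self: "X \<in> S \<Longrightarrow> X \<in> iso_class S X"
  by (simp add: iso_class_def isomorphic_refl)

lemma iso_class_Un: "iso_class (S \<union> T) X = iso_class S X \<union> iso_class T X"
  by (auto simp: iso_class_def)

lemma matched_iso_class_iff:
  assumes "X \<in> S" and "Y \<in> T"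
  shows "matched (iso_class S X) (iso_class T Y) \<longleftrightarrow> isomorphic X Y"
proof
  assume "matched (iso_class S X) (iso_class T Y)"
  then show "isomorphic X Y"
    using assms by (simp add: matched_def iso_class_self)
next
  assume "isomorphic X Y"
  then show "matched (iso_class S X) (iso_class T Y)"
    unfolding matched_def iso_class_def
    using isomorphic_sym isomorphic_trans by blast
qed

text \<open>The class of \<open>Z\<close> in \<open>S \<union> T\<close> is its class in
  \<open>S\<close> together with its class in \<open>T\<close>, and at most one of the two is empty.
  The three possibilities are the three kinds of sets in \<open>merged_classes\<close>. Families
  thus become plain isomorphism classes, with no reference to the two sides.\<close>

lemma merged_classes_iso_classes:
  "merged_classes (iso_classes S) (iso_classes T) = iso_classes (S \<union> T)"
proof (intro equalityI subsetI)
  fix \<Gamma> assume "\<Gamma> \<in> merged_classes (iso_classes S) (iso_classes T)"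
  then consider
      (both) X Y where "X \<in> S" "Y \<in> T" "isomorphic X Y" "\<Gamma> = iso_class S X \<union> iso_class T Y"
    | (left) X where "X \<in> S" "\<forall>Y\<in>T. \<not> isomorphic X Y" "\<Gamma> = iso_class S X"
    | (right) Y where "Y \<in> T" "\<forall>X\<in>S. \<not> isomorphic X Y" "\<Gamma> = iso_class T Y"
    unfolding merged_classes_def iso_classes_eq
    by (auto simp: matched_iso_class_iff)
  then show "\<Gamma> \<in> iso_classes (S \<union> T)"
  proof cases
    case both
    then have "\<Gamma> = iso_class (S \<union> T) X"
      by (simp add: iso_class_Un iso_class_cong[of X Y T])
    then show ?thesis using both by (auto simp: iso_classes_eq)
  next
    case left
    then have "\<Gamma> = iso_class (S \<union> T) X" by (auto simp: iso_class_def)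
    then show ?thesis using left by (auto simp: iso_classes_eq)
  next
    case right
    then have "\<Gamma> = iso_class (S \<union> T) Y" by (auto simp: iso_class_def dest: isomorphic_sym)
    then show ?thesis using right by (auto simp: iso_classes_eq)
  qed
next
  fix \<Gamma> assume "\<Gamma> \<in> iso_classes (S \<union> T)"
  then obtain Z where Z: "Z \<in> S \<union> T" and \<Gamma>: "\<Gamma> = iso_class (S \<union> T) Z"
    by (auto simp: iso_classes_eq)
  \<comment> \<open>By reflexivity \<open>Z\<close> serves as \<open>X\<close> or as
    \<open>Y\<close> on the side it comes from, so \<open>both\<close> covers either origin.\<close>
  consider
      (both) X Y where "X \<in> S" "Y \<in> T" "isomorphic Z X" "isomorphic Z Y"
    | (left) "Z \<in> S" "\<forall>Y\<in>T. \<not> isomorphic Z Y"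
    | (right) "Z \<in> T" "\<forall>X\<in>S. \<not> isomorphic Z X"
    using Z isomorphic_refl by blast
  then show "\<Gamma> \<in> merged_classes (iso_classes S) (iso_classes T)"
  proof cases
    case both
    have "isomorphic X Y" using both(3,4) isomorphic_sym isomorphic_trans by blast
    then have "matched (iso_class S X) (iso_class T Y)"
      using both(1,2) by (simp add: matched_iso_class_iff)
    moreover have "\<Gamma> = iso_class S X \<union> iso_class T Y"
      using \<Gamma> iso_class_cong[OF both(3)] iso_class_cong[OF both(4)]
      by (simp add: iso_class_Un)
    ultimately show ?thesis using both(1,2) by (auto simp: merged_classes_def iso_classes_eq)
  next
    case left
    then have "\<Gamma> = iso_class S Z" using \<Gamma> by (auto simp: iso_class_def)
    then show ?thesis using left
      by (auto simp: merged_classes_def iso_classes_eq matched_iso_class_iff)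
  next
    case right
    then have "\<Gamma> = iso_class T Z" using \<Gamma> by (auto simp: iso_class_def)
    moreover have "\<forall>X\<in>S. \<not> isomorphic X Z" using right isomorphic_sym by blast
    ultimately show ?thesis using right
      by (auto simp: merged_classes_def iso_classes_eq matched_iso_class_iff)
  qed
qed

section \<open>Blocks as components of the complement\<close>

text \<open>Adjacency in the complement, with a loop at every vertex when \<open>G\<close> is
  simple: \<open>{v, v}\<close> is a singleton and hence no edge. This matches
  \<open>non_nbhd G v\<close>, which contains \<open>v\<close>.\<close>

definition non_adj :: "'a graph \<Rightarrow> ('a \<times> 'a) set" where
  "non_adj G = {(u, v). u \<in> verts G \<and> v \<in> verts G \<and> {u, v} \<notin> edges G}"

definition co_component :: "'a graph \<Rightarrow> 'a \<Rightarrow> 'a set" where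
  "co_component G v = (non_adj G)\<^sup>* `` {v}"

lemma non_nbhd_eq: "v \<in> verts G \<Longrightarrow> non_nbhd G v = non_adj G `` {v}"
  by (auto simp: non_nbhd_def nbhd_def non_adj_def)

lemma sym_non_adj: "sym (non_adj G)"
  by (auto simp: sym_def non_adj_def insert_commute)

lemma non_adj_refl: "simple_graph G \<Longrightarrow> v \<in> verts G \<Longrightarrow> (v, v) \<in> non_adj G"
  by (auto simp: simple_graph_def non_adj_def)

lemma self_in_co_component: "v \<in> co_component G v"
  by (simp add: co_component_def)

lemma co_component_subset: "v \<in> verts G \<Longrightarrow> co_component G v \<subseteq> verts G"
  by (auto simp: co_component_def non_adj_def elim: rtranclE)

lemma co_component_eq:
  assumes "w \<in> co_component G v"
  shows "co_component G w = co_component G v"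
proof -
  have "(v, w) \<in> (non_adj G)\<^sup>*" using assms by (simp add: co_component_def)
  moreover from this have "(w, v) \<in> (non_adj G)\<^sup>*"
    using sym_rtrancl[OF sym_non_adj] by (rule symD[rotated])
  ultimately show ?thesis unfolding co_component_def by (auto intro: rtrancl_trans)
qed

text \<open>Absorbing only sets that meet the current one never leaves the component of
  \<open>v\<close>. Conversely, a set that admits no further absorption is closed under
  non-adjacency, because each vertex lies in its own \<open>non_nbhd\<close>; so it contains all
  that is reachable from \<open>v\<close>.\<close>

lemma block_from_eq_co_component:
  assumes G: "simple_graph G" and v: "v \<in> verts G" and A: "block_from G v A"
  shows "A = co_component G v"
proof -
  have "(absorb G)\<^sup>*\<^sup>* (non_nbhd G v) A" using A by (simp add: block_from_def)
  then have sub: "non_nbhd G v \<subseteq> A \<and> A \<subseteq> co_component G v"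
  proof induction
    case base
    then show ?case using v by (auto simp: non_nbhd_eq co_component_def)
  next
    case (step B C)
    from step.hyps(2) obtain u where u: "u \<in> verts G" "non_nbhd G u \<inter> B \<noteq> {}"
      "C = B \<union> non_nbhd G u" by (auto simp: absorb.simps)
    then obtain w where w: "w \<in> co_component G v" "(u, w) \<in> non_adj G"
      using step.IH by (auto simp: non_nbhd_eq)
    \<comment> \<open>The common vertex \<open>w\<close> lies in both components, so they
      coincide.\<close>
    have "co_component G u = co_component G v"
      using w co_component_eq[of w G u] co_component_eq[of w G v]
      by (auto simp: co_component_def)
    then have "non_nbhd G u \<subseteq> co_component G v"
      using u(1) by (auto simp: non_nbhd_eq co_component_def)
    then show ?case using u step.IH by auto
  qed
  have "w \<in> A" if "(v, w) \<in> (non_adj G)\<^sup>*" for w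
    using that
  proof induction
    case base
    then show ?case using sub v non_adj_refl[OF G v] by (auto simp: non_nbhd_eq)
  next
    case (step x y)
    then have x: "x \<in> verts G" by (auto simp: non_adj_def)
    then have "non_nbhd G x \<inter> A \<noteq> {}"
      using step.IH non_adj_refl[OF G x] by (auto simp: non_nbhd_eq)
    then have "non_nbhd G x \<subseteq> A"
      using A x by (auto simp: block_from_def absorb.simps)
    then show ?case using step.hyps(2) x by (auto simp: non_nbhd_eq)
  qed
  then show ?thesis using sub by (auto simp: co_component_def)
qed

text \<open>Makes the blocks independent of all choices in the run. Every component occurs because
  its starting vertex is covered by some block, and components that share a vertex are
  equal.\<close>

lemma block_partition_eq_co_components:
  assumes G: "simple_graph G" and V: "V \<subseteq> verts G" and As: "block_partition G V As"
  shows "set As = co_component G ` V"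
proof -
  have "block_run G V As" and cover: "V \<subseteq> \<Union>(set As)"
    using As by (auto simp: block_partition_def)
  from this(1) have sub: "set As \<subseteq> co_component G ` V"
  proof induction
    case (2 As v A)
    then have "A = co_component G v" using V by (intro block_from_eq_co_component[OF G]) auto
    then show ?case using 2 by auto
  qed simp
  moreover have "co_component G v \<in> set As" if v: "v \<in> V" for v
  proof -
    obtain A where A: "A \<in> set As" "v \<in> A" using cover v by blast
    then obtain w where "A = co_component G w" using sub by blast
    then show ?thesis using A co_component_eq by metis
  qed
  ultimately show ?thesis by blast
qed

lemma automorphism_image_co_component_subset:
  assumes f: "isomorphism G G f" and v: "v \<in> verts G"
  shows "f ` co_component G v \<subseteq> co_component G (f v)"
proof -
  have step: "(f x, f y) \<in> non_adj G" if "(x, y) \<in> non_adj G" for x y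
    using f that by (auto simp: isomorphism_def bij_betw_def non_adj_def)
  have "(f v, f w) \<in> (non_adj G)\<^sup>*" if "(v, w) \<in> (non_adj G)\<^sup>*" for w
    using that by induction (auto intro: step rtrancl_into_rtrancl)
  then show ?thesis by (auto simp: co_component_def)
qed

text \<open>The reverse inclusion is the forward one applied to the inverse automorphism.\<close>

lemma automorphism_image_co_component:
  assumes f: "isomorphism G G f" and v: "v \<in> verts G"
  shows "f ` co_component G v = co_component G (f v)"
proof
  show "f ` co_component G v \<subseteq> co_component G (f v)"
    using assms by (rule automorphism_image_co_component_subset)
  let ?g = "inv_into (verts G) f"
  have bij: "bij_betw f (verts G) (verts G)" using f by (simp add: isomorphism_def)
  then have fv: "f v \<in> verts G" using v by (auto simp: bij_betw_def)
  have "?g ` co_component G (f v) \<subseteq> co_component G (?g (f v))"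
    using isomorphism_inv_into[OF f] fv by (rule automorphism_image_co_component_subset)
  also have "?g (f v) = v" using bij v by (simp add: bij_betw_inv_into_left)
  finally have "f ` ?g ` co_component G (f v) \<subseteq> f ` co_component G v" by blast
  moreover have "f (?g w) = w" if "w \<in> co_component G (f v)" for w
    using that co_component_subset[OF fv] bij by (auto simp: bij_betw_inv_into_right)
  ultimately show "co_component G (f v) \<subseteq> f ` co_component G v"
    by (force simp: image_image)
qed

section \<open>Restricting isomorphisms to induced subgraphs\<close>

lemma verts_induced [simp]: "verts (induced G X) = X"
  by (simp add: induced_def)

lemma edges_induced [simp]: "edges (induced G X) = {e \<in> edges G. e \<subseteq> X}"
  by (simp add: induced_def)

lemma isomorphism_induced:
  assumes f: "isomorphism G G f" and X: "X \<subseteq> verts G"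
  shows "isomorphism (induced G X) (induced G (f ` X)) f"
proof -
  have "inj_on f X" using f X by (auto simp: isomorphism_def bij_betw_def intro: inj_on_subset)
  then show ?thesis
    using f X by (auto simp: isomorphism_def bij_betw_def subset_iff)
qed

section \<open>The distinguishing index of a graph from its families\<close>

text \<open>A finite bound excludes the infimum of the empty set, and since \<open>enat\<close> is
  well-ordered the infimum of a nonempty set is attained. Colours below \<open>d\<close> are also
  below any \<open>m \<ge> d\<close>.\<close>

lemma distinguishing_index_le_iff:
  "distinguishing_index X \<le> enat m \<longleftrightarrow> (\<exists>c. c ` edges X \<subseteq> {..<m} \<and> distinguishing X c)"
proof
  let ?D = "{enat d | d. \<exists>c. c ` edges X \<subseteq> {..<d} \<and> distinguishing X c}"
  assume le: "distinguishing_index X \<le> enat m"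
  then have "?D \<noteq> {}" by (auto simp: distinguishing_index_def Inf_enat_def simp del: Collect_empty_eq)
  then have "Inf ?D \<in> ?D" by (metis (no_types, lifting) wellorder_InfI ex_in_conv)
  then obtain d c where "Inf ?D = enat d" "c ` edges X \<subseteq> {..<d}" "distinguishing X c"
    by blast
  moreover from this have "d \<le> m" using le by (simp add: distinguishing_index_def)
  ultimately show "\<exists>c. c ` edges X \<subseteq> {..<m} \<and> distinguishing X c"
    by (meson lessThan_subset_iff subset_trans)
next
  assume "\<exists>c. c ` edges X \<subseteq> {..<m} \<and> distinguishing X c"
  then show "distinguishing_index X \<le> enat m"
    unfolding distinguishing_index_def by (intro Inf_lower) blast
qed

text \<open>In an edgeless graph the transposition of \<open>u\<close> and \<open>v\<close> is an
  automorphism and preserves every colouring vacuously.\<close>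

lemma distinguishing_edgeless:
  assumes "distinguishing X c" and "edges X = {}" and "u \<in> verts X" and "v \<in> verts X"
  shows "u = v"
proof -
  define f where "f = id(u := v, v := u)"
  have "bij_betw f (verts X) (verts X)"
    using assms(3,4) by (auto simp: f_def bij_betw_def inj_on_def image_iff)
  then have "f u = u"
    using assms by (auto simp: distinguishing_def isomorphism_def)
  then show ?thesis by (auto simp: f_def split: if_splits)
qed

text \<open>The vertex set of the family containing the block of \<open>v\<close>. Indexing by
  vertices avoids handling classes of graphs in the colouring argument.\<close>

definition co_family :: "'a graph \<Rightarrow> 'a \<Rightarrow> 'a set" where
  "co_family G v =
     {w \<in> verts G. isomorphic (induced G (co_component G v)) (induced G (co_component G w))}"

lemma self_in_co_family: "v \<in> verts G \<Longrightarrow> v \<in> co_family G v"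
  by (simp add: co_family_def isomorphic_refl)

lemma co_family_eq: "w \<in> co_family G v \<Longrightarrow> co_family G w = co_family G v"
  unfolding co_family_def using isomorphic_sym isomorphic_trans by blast

lemma Union_verts_iso_class:
  assumes "v \<in> verts G"
  shows "(\<Union>X\<in>iso_class (induced G ` co_component G ` verts G) (induced G (co_component G v)).
    verts X) = co_family G v"
proof (intro equalityI subsetI)
  fix x
  assume "x \<in> (\<Union>X\<in>iso_class (induced G ` co_component G ` verts G)
    (induced G (co_component G v)). verts X)"
  then obtain w where "w \<in> verts G" "x \<in> co_component G w"
    "isomorphic (induced G (co_component G v)) (induced G (co_component G w))"
    by (auto simp: iso_class_def)
  then show "x \<in> co_family G v"
    using co_component_eq[of x G w] co_component_subset[of w G] by (auto simp: co_family_def)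
next
  fix x
  assume "x \<in> co_family G v"
  then show "x \<in> (\<Union>X\<in>iso_class (induced G ` co_component G ` verts G)
    (induced G (co_component G v)). verts X)"
    by (auto simp: iso_class_def co_family_def intro: self_in_co_component)
qed

text \<open>\<open>f\<close> maps the component of \<open>w\<close> isomorphically onto that of
  \<open>f w\<close>, so it keeps isomorphism types; an injective self-map of a finite set is
  onto.\<close>

lemma automorphism_image_co_family:
  assumes G: "simple_graph G" and f: "isomorphism G G f"
  shows "f ` co_family G v = co_family G v"
proof (rule endo_inj_surj)
  have bij: "bij_betw f (verts G) (verts G)" using f by (simp add: isomorphism_def)
  have sub: "co_family G v \<subseteq> verts G" by (auto simp: co_family_def)
  show "finite (co_family G v)"
    using G sub by (auto simp: simple_graph_def intro: finite_subset)
  show "inj_on f (co_family G v)"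
    using bij sub by (auto simp: bij_betw_def intro: inj_on_subset)
  show "f ` co_family G v \<subseteq> co_family G v"
  proof
    fix y assume "y \<in> f ` co_family G v"
    then obtain w where w: "w \<in> verts G" "y = f w"
      "isomorphic (induced G (co_component G v)) (induced G (co_component G w))"
      by (auto simp: co_family_def)
    have "isomorphic (induced G (co_component G w)) (induced G (co_component G y))"
      using isomorphism_induced[OF f co_component_subset[OF w(1)]]
      by (auto simp: isomorphic_def automorphism_image_co_component[OF f w(1)] w(2))
    moreover have "y \<in> verts G" using w bij by (auto simp: bij_betw_def)
    ultimately show "y \<in> co_family G v"
      using w(3) isomorphic_trans by (auto simp: co_family_def)
  qed
qed

lemma distinguishing_from_co_families:
  assumes G: "simple_graph G"
    and fam: "\<And>v. v \<in> verts G \<Longrightarrow> distinguishing_index (induced G (co_family G v)) \<le> enat m"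
  shows "distinguishing_index G \<le> enat m"
proof -
  \<comment> \<open>The colouring is chosen per set \<open>W\<close>, not per vertex, so that all
    vertices of one family share it.\<close>
  have "\<exists>c. W \<in> co_family G ` verts G \<longrightarrow>
      c ` edges (induced G W) \<subseteq> {..<m} \<and> distinguishing (induced G W) c" for W
    using fam unfolding distinguishing_index_le_iff by blast
  then obtain c where c: "\<And>W. W \<in> co_family G ` verts G \<Longrightarrow>
      c W ` edges (induced G W) \<subseteq> {..<m} \<and> distinguishing (induced G W) (c W)"
    by metis
  define inner where "inner e v \<longleftrightarrow> v \<in> verts G \<and> e \<subseteq> co_family G v" for e v
  \<comment> \<open>Edges between different families receive the default colour 0.\<close>
  define col where "col e = (if \<exists>v. inner e v then c (co_family G (SOME v. inner e v)) e else 0)"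
    for e
  \<comment> \<open>The choice by \<open>SOME\<close> is harmless: an edge is nonempty, and families
    that share a vertex are equal.\<close>
  have col_inner: "col e = c (co_family G v) e" if inner: "inner e v" and e: "e \<in> edges G" for e v
  proof -
    define w where "w = (SOME v. inner e v)"
    have "inner e w" unfolding w_def using inner by (rule someI)
    moreover obtain x where "x \<in> e" using e G by (force simp: simple_graph_def)
    ultimately have "x \<in> co_family G w" "x \<in> co_family G v"
      using inner by (auto simp: inner_def)
    then have "co_family G w = co_family G v" by (metis co_family_eq)
    then show ?thesis using inner by (auto simp: col_def w_def)
  qed
  have "col e < m" if e: "e \<in> edges G" for e
  proof (cases "\<exists>v. inner e v")
    case True
    then obtain v where v: "inner e v" by blast
    then show ?thesis
      using col_inner[OF v e] c[of "co_family G v"] e by (auto simp: inner_def)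
  next
    case False
    \<comment> \<open>The default colour is admissible only if some colour exists. With
      \<open>m = 0\<close> every family would be edgeless, hence a single vertex.\<close>
    have "0 < m"
    proof (rule ccontr)
      assume m: "\<not> 0 < m"
      have single: "x = v" if "v \<in> verts G" "x \<in> co_family G v" for v x
      proof (rule distinguishing_edgeless)
        show "distinguishing (induced G (co_family G v)) (c (co_family G v))"
          and "edges (induced G (co_family G v)) = {}"
          using c[of "co_family G v"] that(1) m by auto
      qed (use that self_in_co_family in auto)
      \<comment> \<open>A component lies inside its family, so it is a single vertex as
        well.\<close>
      have comp: "co_component G v = {v}" if v: "v \<in> verts G" for v
      proof -
        have "x \<in> co_family G v" if "x \<in> co_component G v" for x
          using that v co_component_eq[OF that] co_component_subset[OF v]
          by (auto simp: co_family_def isomorphic_refl)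
        then show ?thesis using single[OF v] self_in_co_component[of v G] by blast
      qed
      have noloop: "{v} \<notin> edges G" for v using G by (auto simp: simple_graph_def)
      have "isomorphism (induced G {u}) (induced G {v}) (\<lambda>_. v)" for u v
        using noloop by (simp add: isomorphism_def bij_betw_def)
      then have iso: "isomorphic (induced G {u}) (induced G {v})" for u v
        by (auto simp: isomorphic_def)
      have "e \<noteq> {}" "e \<subseteq> verts G" using e G by (auto simp: simple_graph_def)
      \<comment> \<open>All components are isomorphic one-vertex graphs, so one family contains
        every vertex and hence \<open>e\<close>, which was assumed to lie in none.\<close>
      then obtain v where "v \<in> verts G" "e \<subseteq> co_family G v"
        using comp iso unfolding co_family_def by fastforce
      then show False using False by (simp add: inner_def)
    qed
    then show ?thesis using False by (simp add: col_def)
  qed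
  moreover have "distinguishing G col"
    unfolding distinguishing_def
  proof (intro allI impI ballI, elim conjE)
    fix f v
    assume f: "isomorphism G G f" and pres: "\<forall>e\<in>edges G. col (f ` e) = col e"
      and v: "v \<in> verts G"
    let ?W = "co_family G v"
    have W: "?W \<subseteq> verts G" by (auto simp: co_family_def)
    have fW: "f ` ?W = ?W" using G f by (rule automorphism_image_co_family)
    have "isomorphism (induced G ?W) (induced G ?W) f"
      using isomorphism_induced[OF f W] by (simp add: fW)
    \<comment> \<open>Both \<open>e\<close> and its image are edges inside \<open>?W\<close>, where
      \<open>col\<close> agrees with \<open>c ?W\<close>.\<close>
    moreover have "c ?W (f ` e) = c ?W e" if "e \<in> edges (induced G ?W)" for e
    proof -
      have e: "e \<in> edges G" "e \<subseteq> ?W" using that by auto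
      then obtain x y where xy: "e = {x, y}" using G by (auto simp: simple_graph_def card_2_iff)
      then have "f ` e \<in> edges G" using e f W by (auto simp: isomorphism_def)
      moreover have "inner (f ` e) v" "inner e v" using e(2) fW v by (auto simp: inner_def)
      ultimately show ?thesis using pres e(1) col_inner by metis
    qed
    ultimately show "f v = v"
      using c[of ?W] v self_in_co_family[OF v] by (auto simp: distinguishing_def)
  qed
  ultimately show ?thesis unfolding distinguishing_index_le_iff by blast
qed

section \<open>Application to the join of two disjoint graphs\<close>

lemma simple_graph_join:
  assumes "simple_graph G1" and "simple_graph G2" and "verts G1 \<inter> verts G2 = {}"
  shows "simple_graph (join G1 G2)"
proof -
  \<comment> \<open>Disjointness of the vertex sets keeps the cross edges from being loops.\<close>
  have "card {u, v} = 2" if "u \<in> verts G1" "v \<in> verts G2" for u v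
    using assms(3) that by (subst card_2_iff) blast
  then show ?thesis using assms(1,2) by (auto simp: simple_graph_def join_def)
qed

theorem theorem3p7:
  fixes G1 G2 :: "'a graph" and As Bs :: "'a set list"
  assumes "simple_graph G1" and "simple_graph G2"
    and "verts G1 \<inter> verts G2 = {}"
    and "block_partition (join G1 G2) (verts G1) As"
    and "block_partition (join G1 G2) (verts G2) Bs"
  shows "distinguishing_index (join G1 G2)
    \<le> (SUP H \<in> family_graphs (join G1 G2) As Bs. distinguishing_index H)"
proof -
  define G where "G = join G1 G2"
  have G: "simple_graph G" unfolding G_def using assms(1-3) by (rule simple_graph_join)
  have V: "verts G = verts G1 \<union> verts G2" by (simp add: G_def join_def)
  have "set As = co_component G ` verts G1" "set Bs = co_component G ` verts G2"
    using block_partition_eq_co_components[OF G] assms(4,5) V by (auto simp: G_def)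
  then have "families G As Bs = iso_classes (induced G ` co_component G ` verts G)"
    by (simp add: families_def merged_classes_iso_classes V image_Un)
  also have "\<dots> = (\<lambda>v. iso_class (induced G ` co_component G ` verts G)
      (induced G (co_component G v))) ` verts G"
    by (simp only: iso_classes_eq image_image)
  finally have "family_graphs G As Bs = (\<lambda>v. induced G (co_family G v)) ` verts G"
    unfolding family_graphs_def
    by (simp only: image_image[where f = "\<lambda>\<Gamma>. induced G (\<Union>X\<in>\<Gamma>. verts X)"]
        Union_verts_iso_class cong: image_cong)
  then have le: "distinguishing_index (induced G (co_family G v))
      \<le> (SUP H \<in> family_graphs G As Bs. distinguishing_index H)" if "v \<in> verts G" for v
    using that by (auto intro: SUP_upper)
  have "distinguishing_index G \<le> (SUP H \<in> family_graphs G As Bs. distinguishing_index H)"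
  \<comment> \<open>An infinite supremum bounds everything; a finite one is a single
    \<open>m\<close> that bounds all families at once.\<close>
  proof (cases "SUP H \<in> family_graphs G As Bs. distinguishing_index H")
    case (enat m)
    then show ?thesis using distinguishing_from_co_families[OF G, of m] le by simp
  qed simp
  then show ?thesis by (simp add: G_def)
qed

end
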